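(* Let $l\in\{1,\dots,n\}$. For sufficiently large $n,N$, when $\pi_{\max}\le \frac1{20}$, one has $$\tau_l \;\ge\; 0.4\cdot \frac{l(l-1)}{n(n-1)}\cdot \mathsf{weight}\left(\pi,\left[\frac23\,\frac{l-1}{n-1},\ \frac43\,\frac{l}{n}\right]\right).$$
   Context: $X$ is a finite domain with $|X|=N$, and $n$ is the number of training samples. $\pi=\{\pi_1,\dots,\pi_N\}$ is a list of $N$ prior probabilities (nonnegative, summing to 1), and $\pi_{\max}:=\max_{j\in[N]}\pi_j$. A random distribution $D$ on $X$ is generated as follows: for each $x\in X$ sample $p_x$ independently and uniformly from the list $\pi$, and set $D(x)=p_x/\sum_{x'\in X}p_{x'}$. Let $\bar\pi^N$ denote the resulting marginal distribution of $D(x)$ for a single $x$, i.e. $\bar\pi^N(\alpha)=\mathbb P[D(x)=\alpha]$. Define $$\tau_l := \frac{\mathbb E_{\alpha\sim\bar\pi^N}[\alpha^{l+1}(1-\alpha)^{n-l}]}{\mathbb E_{\alpha\sim\bar\pi^N}[\alpha^{l}(1-\alpha)^{n-l}]}.$$ For $\beta_1\le\beta_2$, $\mathsf{weight}(\pi,[\beta_1,\beta_2])$ is the expected fraction of the distribution $D$ contributed by frequencies in $[\beta_1,\beta_2]$: $$\mathsf{weight}(\pi,[\beta_1,\beta_2]):=\mathbb E\left[\sum_{x\in X}D(x)\cdot \mathbf 1\big(D(x)\in[\beta_1,\beta_2]\big)\right],$$ where the expectation is over the random generation of $D$ from $\pi$, i.e. over sampling each $p_x$, $x\in X$, independently and uniformly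 from the list $\pi$, followed by the normalization $D(x)=p_x/\sum_{x'\in X}p_{x'}$. *)

theory Defs
  imports "HOL-Probability.Probability"
begin

definition is_prior :: "nat \<Rightarrow> real list \<Rightarrow> bool" where
  "is_prior N \<pi> \<longleftrightarrow> length \<pi> = N \<and> (\<forall>p\<in>set \<pi>. 0 \<le> p) \<and> sum_list \<pi> = 1"

definition prior_max :: "real list \<Rightarrow> real" where
  "prior_max \<pi> = Max (set \<pi>)"

text \<open>
  The index, not the value, is drawn uniformly, so that repeated entries of the list count
  with multiplicity. Meaningful for nonempty lists only.
\<close>
definition prior_pmf :: "real list \<Rightarrow> real pmf" where
  "prior_pmf \<pi> = map_pmf (\<lambda>j. \<pi> ! j) (pmf_of_set {..<length \<pi>})"

text \<open>
  If the list has zero entries, all samples may vanish simultaneously, and the normalization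
  is then undefined mathematically. By the convention \<open>0 / 0 = 0\<close>, \<open>D\<close> is the zero function
  on this event, so for \<open>l \<ge> 1\<close> the event contributes nothing to either expectation
  in \<open>tau\<close> and nothing to \<open>prior_weight\<close>.
\<close>
definition random_dist :: "'a set \<Rightarrow> real list \<Rightarrow> ('a \<Rightarrow> real) pmf" where
  "random_dist X \<pi> =
     map_pmf (\<lambda>p x. p x / (\<Sum>x'\<in>X. p x')) (Pi_pmf X 0 (\<lambda>_. prior_pmf \<pi>))"

text \<open>By symmetry, this does not depend on the choice of \<open>x \<in> X\<close>.\<close>
definition marginal :: "'a set \<Rightarrow> real list \<Rightarrow> 'a \<Rightarrow> real pmf" where
  "marginal X \<pi> x = map_pmf (\<lambda>D. D x) (random_dist X \<pi>)"

definition tau :: "'a set \<Rightarrow> real list \<Rightarrow> 'a \<Rightarrow> nat \<Rightarrow> nat \<Rightarrow> real" where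
  "tau X \<pi> x n l =
     measure_pmf.expectation (marginal X \<pi> x) (\<lambda>\<alpha>. \<alpha> ^ (l + 1) * (1 - \<alpha>) ^ (n - l)) /
     measure_pmf.expectation (marginal X \<pi> x) (\<lambda>\<alpha>. \<alpha> ^ l * (1 - \<alpha>) ^ (n - l))"

definition prior_weight :: "'a set \<Rightarrow> real list \<Rightarrow> real set \<Rightarrow> real" where
  "prior_weight X \<pi> B =
     measure_pmf.expectation (random_dist X \<pi>) (\<lambda>D. \<Sum>x\<in>X. D x * indicator B (D x))"

end

theory Submission
  imports Defs
begin

text \<open>
  Let \<open>\<alpha>\<close> be the frequency of the given point and \<open>I\<close> the interval of the theorem. By
  exchangeability, \<open>prior_weight\<close> is \<open>N\<close> times the mean of \<open>\<alpha> * indicator I \<alpha>\<close>, while the mean of \<open>\<alpha>\<close> is at most \<open>1 / N\<close>. So for \<open>t\<close> below the mode of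
  \<open>v a = a ^ (l - 1) * (1 - a) ^ (n - l)\<close>, the part of the denominator of \<open>tau\<close> with \<open>\<alpha> \<le> t\<close>
  is at most \<open>v t / N\<close>, and the part with \<open>\<alpha> > t\<close> is at most the numerator over \<open>t\<close>;
  a lower bound for the numerator in terms of \<open>prior_weight\<close> finishes the proof. If \<open>3 l \<le> n\<close>,
  this bound comes from \<open>a * v a\<close> being no smaller on \<open>I\<close> than at
  \<open>t = (l - 1) / (n - 1) / 3\<close>. Otherwise take \<open>t = 1 / 10\<close>: a part of \<open>I\<close> may then lie near 1,
  where the kernel vanishes, but an assignment with \<open>\<alpha> > 1 / 2\<close> can be changed at one
  further point to move \<open>\<alpha>\<close> into \<open>[1/3, 1/2]\<close>; moreover \<open>prior_weight\<close> is at most 1/32 because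
  \<open>\<alpha> \<ge> 1 / 5\<close> forces the sum of the sampled priors to be at most 1/4.
\<close>

section \<open>Reduction to averages over index assignments\<close>

text \<open>Recording indices instead of priors makes the model uniform on a finite set:
  expectations become finite sums, and assignments can be counted by injections.\<close>

definition assignments :: "'a set \<Rightarrow> real list \<Rightarrow> ('a \<Rightarrow> nat) set" where
  "assignments X \<pi> = X \<rightarrow>\<^sub>E {..<length \<pi>}"

definition freq :: "'a set \<Rightarrow> real list \<Rightarrow> ('a \<Rightarrow> nat) \<Rightarrow> 'a \<Rightarrow> real" where
  "freq X \<pi> c x = \<pi> ! c x / (\<Sum>y\<in>X. \<pi> ! c y)"

lemma finite_assignments: "finite X \<Longrightarrow> finite (assignments X \<pi>)"
  by (simp add: assignments_def finite_PiE)

lemma assignments_nonempty: "\<pi> \<noteq> [] \<Longrightarrow> assignments X \<pi> \<noteq> {}"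
  by (auto simp: assignments_def PiE_eq_empty_iff lessThan_empty_iff bot_nat_def)

lemma Pi_pmf_prior_pmf:
  assumes "finite X" "\<pi> \<noteq> []"
  shows "Pi_pmf X 0 (\<lambda>_. prior_pmf \<pi>) =
    map_pmf (\<lambda>c x. if x \<in> X then \<pi> ! c x else 0) (pmf_of_set (assignments X \<pi>))"
proof -
  have dflt: "PiE_dflt X undefined (\<lambda>_. {..<length \<pi>}) = assignments X \<pi>"
    unfolding PiE_dflt_def assignments_def by (fastforce simp: PiE_iff extensional_def)
  \<comment> \<open>\<open>Pi_pmf_map\<close> needs the default value to be the image of the default
    index, here \<open>undefined\<close>; the outer map restores the value 0 off
    \<open>X\<close>.\<close>
  have "Pi_pmf X 0 (\<lambda>_. prior_pmf \<pi>) =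
      map_pmf (\<lambda>f x. if x \<in> X then f x else 0) (Pi_pmf X (\<pi> ! undefined) (\<lambda>_. prior_pmf \<pi>))"
    using assms by (simp add: Pi_pmf_default_swap)
  also have "Pi_pmf X (\<pi> ! undefined) (\<lambda>_. prior_pmf \<pi>) =
      map_pmf (\<lambda>h. (!) \<pi> \<circ> h) (Pi_pmf X undefined (\<lambda>_. pmf_of_set {..<length \<pi>}))"
    unfolding prior_pmf_def by (rule Pi_pmf_map) (use assms in auto)
  also have "Pi_pmf X undefined (\<lambda>_. pmf_of_set {..<length \<pi>}) = pmf_of_set (assignments X \<pi>)"
    using assms by (subst Pi_pmf_of_set) (auto simp: dflt lessThan_empty_iff bot_nat_def)
  finally show ?thesis by (simp add: map_pmf_comp o_def cong: if_cong)
qed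

lemma random_dist_eq:
  assumes "finite X" "\<pi> \<noteq> []"
  shows "random_dist X \<pi> =
    map_pmf (\<lambda>c x. if x \<in> X then freq X \<pi> c x else 0) (pmf_of_set (assignments X \<pi>))"
proof -
  have *: "(\<Sum>y\<in>X. if y \<in> X then \<pi> ! c y else 0) = (\<Sum>y\<in>X. \<pi> ! c y)" for c
    by (rule sum.cong) auto
  show ?thesis
    using assms by (auto simp: random_dist_def Pi_pmf_prior_pmf map_pmf_comp freq_def * intro!: map_pmf_cong)
qed

lemma tau_eq:
  assumes "finite X" "\<pi> \<noteq> []" "x \<in> X"
  shows "tau X \<pi> x n l =
    (\<Sum>c\<in>assignments X \<pi>. freq X \<pi> c x ^ (l + 1) * (1 - freq X \<pi> c x) ^ (n - l)) /
    (\<Sum>c\<in>assignments X \<pi>. freq X \<pi> c x ^ l * (1 - freq X \<pi> c x) ^ (n - l))"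
  using assms finite_assignments[of X \<pi>] assignments_nonempty[of \<pi> X]
  by (simp add: tau_def marginal_def random_dist_eq integral_pmf_of_set)

lemma prior_weight_eq:
  assumes "finite X" "\<pi> \<noteq> []"
  shows "prior_weight X \<pi> B = (\<Sum>c\<in>assignments X \<pi>. \<Sum>x\<in>X. freq X \<pi> c x * indicator B (freq X \<pi> c x)) /
    card (assignments X \<pi>)"
  using assms finite_assignments[of X \<pi>] assignments_nonempty[of \<pi> X]
  by (simp only: prior_weight_def random_dist_eq integral_map_pmf integral_pmf_of_set not_False_eq_True)
    (auto intro!: sum.cong arg_cong2[where f = "(/)"])

section \<open>Exchangeability and bounds on the frequencies\<close>

text \<open>Precomposing with the transposition of \<open>x\<close> and \<open>y\<close> is an
  involution of the assignments that exchanges the two frequencies and preserves the total.\<close>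

lemma sum_assignments_freq_swap:
  assumes "finite X" "x \<in> X" "y \<in> X"
  shows "(\<Sum>c\<in>assignments X \<pi>. g (freq X \<pi> c x)) = (\<Sum>c\<in>assignments X \<pi>. g (freq X \<pi> c y))"
proof -
  let ?\<sigma> = "\<lambda>c. c \<circ> Transposition.transpose x y"
  show ?thesis
  proof (rule sum.reindex_bij_witness[where i = ?\<sigma> and j = ?\<sigma>])
  fix c assume c: "c \<in> assignments X \<pi>"
  show "?\<sigma> (?\<sigma> c) = c" "?\<sigma> (?\<sigma> c) = c" by (simp_all add: comp_assoc)
  have perm: "Transposition.transpose x y permutes X" using assms by (simp add: permutes_swap_id)
  show "?\<sigma> c \<in> assignments X \<pi>" "?\<sigma> c \<in> assignments X \<pi>"
    using c assms perm unfolding assignments_def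
    by (auto simp: PiE_iff extensional_def permutes_in_image permutes_not_in)
  have "(\<Sum>z\<in>X. \<pi> ! ?\<sigma> c z) = (\<Sum>z\<in>X. \<pi> ! c z)"
    using sum.permute[OF perm, of "\<lambda>z. \<pi> ! c z"] by (simp add: o_def)
  then show "g (freq X \<pi> (?\<sigma> c) y) = g (freq X \<pi> c x)" by (simp add: freq_def)
  qed
qed

lemma sum_assignments_sum_freq:
  fixes g :: "real \<Rightarrow> real"
  assumes "finite X" "x \<in> X"
  shows "(\<Sum>c\<in>assignments X \<pi>. \<Sum>y\<in>X. g (freq X \<pi> c y)) =
    card X * (\<Sum>c\<in>assignments X \<pi>. g (freq X \<pi> c x))"
proof -
  have "(\<Sum>y\<in>X. \<Sum>c\<in>assignments X \<pi>. g (freq X \<pi> c y)) =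
      (\<Sum>y\<in>X. \<Sum>c\<in>assignments X \<pi>. g (freq X \<pi> c x))"
    using assms by (intro sum.cong refl sum_assignments_freq_swap)
  then show ?thesis by (subst sum.swap) simp
qed

lemma prior_weight_mult_card:
  assumes "finite X" "\<pi> \<noteq> []" "x \<in> X"
  shows "prior_weight X \<pi> B * (card (assignments X \<pi>) / card X) =
    (\<Sum>c\<in>assignments X \<pi>. freq X \<pi> c x * indicator B (freq X \<pi> c x))"
proof -
  have "card (assignments X \<pi>) \<noteq> 0" "card X \<noteq> 0"
    using assms by (auto simp: finite_assignments assignments_nonempty)
  then show ?thesis
    unfolding prior_weight_eq[OF assms(1,2)]
      sum_assignments_sum_freq[OF assms(1,3), where g = "\<lambda>a. a * indicator B a"]
    by (simp del: card_eq_0_iff)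
qed

lemma prior_nth_le_max: "j < length \<pi> \<Longrightarrow> \<pi> ! j \<le> prior_max \<pi>"
  by (simp add: prior_max_def)

lemma prior_nth_nonneg:
  assumes "is_prior N \<pi>" "c \<in> assignments X \<pi>" "y \<in> X"
  shows "0 \<le> \<pi> ! c y"
proof -
  have "\<pi> ! c y \<in> set \<pi>" using assms by (auto simp: assignments_def PiE_iff)
  then show ?thesis using assms by (simp add: is_prior_def)
qed

lemma freq_bounds:
  assumes "finite X" "is_prior N \<pi>" "c \<in> assignments X \<pi>" "x \<in> X"
  shows "0 \<le> freq X \<pi> c x" "freq X \<pi> c x \<le> 1"
proof -
  have "0 \<le> \<pi> ! c x" "\<pi> ! c x \<le> (\<Sum>y\<in>X. \<pi> ! c y)"
    using assms by (auto intro!: member_le_sum dest: prior_nth_nonneg)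
  then show "0 \<le> freq X \<pi> c x" "freq X \<pi> c x \<le> 1"
    by (auto simp: freq_def divide_le_eq_1)
qed

text \<open>Equality holds unless the total vanishes; then every frequency is 0 by the convention
  for division by zero.\<close>

lemma sum_freq_le_1: "(\<Sum>y\<in>X. freq X \<pi> c y) \<le> 1"
  by (simp add: freq_def flip: sum_divide_distrib)

lemma sum_assignments_freq_le:
  assumes "finite X" "x \<in> X"
  shows "(\<Sum>c\<in>assignments X \<pi>. freq X \<pi> c x) \<le> card (assignments X \<pi>) / card X"
proof -
  have "card X * (\<Sum>c\<in>assignments X \<pi>. freq X \<pi> c x) = (\<Sum>c\<in>assignments X \<pi>. \<Sum>y\<in>X. freq X \<pi> c y)"
    using sum_assignments_sum_freq[of X x "\<lambda>a. a" \<pi>] assms by simp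
  also have "\<dots> \<le> (\<Sum>c\<in>assignments X \<pi>. 1)"
    by (intro sum_mono sum_freq_le_1)
  finally show ?thesis
    using card_gt_0_iff[of X] assms by (auto simp: pos_le_divide_eq mult.commute simp del: card_gt_0_iff)
qed

section \<open>Two counting estimates for the sampled priors\<close>

text \<open>This is independence of the samples in counting form.\<close>

lemma sum_assignments_prod:
  fixes g :: "nat \<Rightarrow> real"
  assumes "finite X"
  shows "(\<Sum>c\<in>assignments X \<pi>. \<Prod>y\<in>X. g (c y)) = (\<Sum>j<length \<pi>. g j) ^ card X"
  using prod_sum_PiE[of X "\<lambda>_. {..<length \<pi>}" "\<lambda>_. g"] assms
  by (simp add: assignments_def)

text \<open>A Chernoff bound at parameter 20: on \<open>[0, 1/20]\<close> one has \<open>exp (- 20 p) \<le> 1 - 10 p\<close>.\<close>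
lemma card_small_sum_le:
  assumes "finite X" "card X = N" "is_prior N \<pi>" "prior_max \<pi> \<le> 1 / 20"
  shows "card {c \<in> assignments X \<pi>. (\<Sum>y\<in>X. \<pi> ! c y) \<le> 1 / 4} \<le> card (assignments X \<pi>) / 32"
proof -
  let ?C = "assignments X \<pi>"
  have len: "length \<pi> = N" and "sum_list \<pi> = 1" using assms by (auto simp: is_prior_def)
  then have sum1: "(\<Sum>j<N. \<pi> ! j) = 1" by (simp add: sum_list_sum_nth lessThan_atLeast0)
  have "N > 0" using sum1 by (cases N) auto
  have bounds: "0 \<le> \<pi> ! j \<and> \<pi> ! j \<le> 1 / 20" if "j < N" for j
    using that assms nth_mem[of j \<pi>] prior_nth_le_max[of j \<pi>] by (auto simp: is_prior_def)
  have exp_le': "exp (- (20 * p)) \<le> 1 - 10 * p" if "0 \<le> p" "p \<le> 1 / 20" for p :: real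
  proof -
    have "exp (- (20 * p)) \<le> 1 / (1 + 20 * p)"
      using that exp_ge_add_one_self[of "20 * p"]
      by (simp add: exp_minus field_simps)
    also have "\<dots> \<le> 1 - 10 * p"
    proof -
      have "0 \<le> 10 * p * (1 - 20 * p)" using that by simp
      then have "1 \<le> (1 - 10 * p) * (1 + 20 * p)" by (simp add: algebra_simps)
      then show ?thesis using that by (simp add: divide_le_eq)
    qed
    finally show ?thesis .
  qed
  have "(\<Sum>j<N. exp (- (20 * \<pi> ! j))) \<le> (\<Sum>j<N. 1 - 10 * \<pi> ! j)"
    by (intro sum_mono exp_le') (use bounds in auto)
  also have "\<dots> = real N - 10"
    by (simp add: sum_subtractf sum1 flip: sum_distrib_left)
  also have "\<dots> \<le> N * exp (- (10 / N))"
    using exp_ge_add_one_self[of "- (10 / N)"] \<open>N > 0\<close> by (simp add: field_simps)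
  finally have mgf: "(\<Sum>j<N. exp (- (20 * \<pi> ! j))) \<le> N * exp (- (10 / N))" .
  have "real (card {c \<in> ?C. (\<Sum>y\<in>X. \<pi> ! c y) \<le> 1 / 4}) =
      (\<Sum>c\<in>?C. if (\<Sum>y\<in>X. \<pi> ! c y) \<le> 1 / 4 then 1 else 0)"
    using assms by (simp add: finite_assignments flip: sum.inter_filter)
  \<comment> \<open>The exponent is nonnegative exactly when the sum is at most 1/4, so this is the
    exponential Markov bound.\<close>
  also have "\<dots> \<le> (\<Sum>c\<in>?C. exp (5 - 20 * (\<Sum>y\<in>X. \<pi> ! c y)))"
    by (intro sum_mono) auto
  also have "\<dots> = exp 5 * (\<Sum>c\<in>?C. \<Prod>y\<in>X. exp (- (20 * \<pi> ! c y)))"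
  proof -
    have "5 - 20 * (\<Sum>y\<in>X. \<pi> ! c y) = 5 + (\<Sum>y\<in>X. - (20 * \<pi> ! c y))" for c
      by (simp add: sum_negf sum_distrib_left)
    then show ?thesis using assms(1) by (simp only: exp_add exp_sum sum_distrib_left)
  qed
  also have "\<dots> = exp 5 * (\<Sum>j<N. exp (- (20 * \<pi> ! j))) ^ N"
    using assms len sum_assignments_prod[of X "\<lambda>j. exp (- (20 * \<pi> ! j))" \<pi>] by simp
  also have "\<dots> \<le> exp 5 * (N * exp (- (10 / N))) ^ N"
    using mgf by (intro mult_left_mono power_mono sum_nonneg) auto
  also have "\<dots> = real N ^ N * exp (5 - 10)"
    using \<open>N > 0\<close> by (simp add: power_mult_distrib flip: exp_of_nat_mult exp_add)
  also have "\<dots> \<le> real N ^ N * (1 / 32)"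
  proof (intro mult_left_mono)
    have "2 ^ 5 \<le> exp (1 :: real) ^ 5"
      using exp_ge_add_one_self[of 1] by (intro power_mono) auto
    then have "32 \<le> exp (5 :: real)" by (simp flip: exp_of_nat_mult)
    then show "exp (5 - 10) \<le> 1 / (32 :: real)" by (simp add: exp_minus field_simps)
  qed simp
  also have "real N ^ N * (1 / 32) = card ?C / 32"
    using assms len by (simp add: assignments_def card_PiE)
  finally show ?thesis by simp
qed

text \<open>
  If \<open>x\<close> carries more than half of the mass then no other point has the index of \<open>x\<close>.
  Overwriting the index of another point \<open>y\<close> by that of \<open>x\<close> brings \<open>freq\<close> into
  \<open>[1/3, 1/2]\<close>. The point \<open>y\<close> can be read off the result, so only the overwritten index is lost:
  there are \<open>N - 1\<close> choices of \<open>y\<close>, and each result arises from at most \<open>N\<close> assignments.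
\<close>
lemma card_large_freq_le:
  assumes X: "finite X" "card X = N" "x \<in> X" and \<pi>: "is_prior N \<pi>" and "N \<ge> 2"
  shows "card {c \<in> assignments X \<pi>. freq X \<pi> c x > 1 / 2} \<le>
    2 * card {c \<in> assignments X \<pi>. freq X \<pi> c x \<in> {1 / 3..1 / 2}}"
    (is "card ?A \<le> 2 * card ?B")
proof -
  let ?C = "assignments X \<pi>" and ?h = "\<lambda>(c, y). (c(y := c x), c y)"
  have len: "length \<pi> = N" using \<pi> by (simp add: is_prior_def)
  have rest: "(\<Sum>z\<in>X - {x}. \<pi> ! c z) < \<pi> ! c x" "0 < \<pi> ! c x" if "c \<in> ?A" for c
  proof -
    have c: "c \<in> ?C" and f: "freq X \<pi> c x > 1 / 2" using that by auto
    have nn: "0 \<le> (\<Sum>z\<in>X. \<pi> ! c z)" using c \<pi> by (intro sum_nonneg prior_nth_nonneg)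
    moreover have "(\<Sum>z\<in>X. \<pi> ! c z) \<noteq> 0" using f by (auto simp: freq_def)
    ultimately have "(\<Sum>z\<in>X. \<pi> ! c z) > 0" by simp
    then have "(\<Sum>z\<in>X. \<pi> ! c z) < 2 * \<pi> ! c x" "0 < \<pi> ! c x"
      using f by (simp_all add: freq_def field_simps)
    then show "(\<Sum>z\<in>X - {x}. \<pi> ! c z) < \<pi> ! c x" "0 < \<pi> ! c x"
      using X by (auto simp: sum.remove[of X x])
  qed
  have other: "c z \<noteq> c x" if "c \<in> ?A" "z \<in> X - {x}" for c z
  proof
    assume "c z = c x"
    moreover have "\<pi> ! c z \<le> (\<Sum>z\<in>X - {x}. \<pi> ! c z)"
      using that X \<pi> by (intro member_le_sum) (auto intro: prior_nth_nonneg)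
    ultimately show False using rest[OF that(1)] by simp
  qed
  have "inj_on ?h (?A \<times> (X - {x}))"
  proof (rule inj_onI)
    fix u v assume u: "u \<in> ?A \<times> (X - {x})" and v: "v \<in> ?A \<times> (X - {x})" and h: "?h u = ?h v"
    obtain c y c' y' where uv: "u = (c, y)" "v = (c', y')" by fastforce
    have c: "c \<in> ?A" and y: "y \<in> X" "y \<noteq> x" and c': "c' \<in> ?A" and y': "y' \<in> X" "y' \<noteq> x"
      and eq: "c(y := c x) = c'(y' := c' x)" and old: "c y = c' y'"
      using u v h by (auto simp: uv)
    have same: "c x = c' x" using fun_cong[OF eq, of x] y y' by simp
    \<comment> \<open>If the points differed, \<open>c'\<close> would already have the index of
      \<open>x\<close> at \<open>y\<close>, against \<open>other\<close>.\<close>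
    have "y = y'"
    proof (rule ccontr)
      assume "y \<noteq> y'"
      then have "c' y = c x" using fun_cong[OF eq, of y] by simp
      then show False using other[of c' y] c' y same by simp
    qed
    moreover have "c = c'"
    proof
      fix z show "c z = c' z" using fun_cong[OF eq, of z] old \<open>y = y'\<close> by (cases "z = y") auto
    qed
    ultimately show "u = v" by (simp add: uv)
  qed
  moreover have "?h ` (?A \<times> (X - {x})) \<subseteq> ?B \<times> {..<N}"
  proof (rule image_subsetI)
    fix u assume u: "u \<in> ?A \<times> (X - {x})"
    obtain c y where uv: "u = (c, y)" by fastforce
    have c: "c \<in> ?C" "freq X \<pi> c x > 1 / 2" and y: "y \<in> X" "y \<noteq> x" using u by (auto simp: uv)
    let ?p = "\<pi> ! c x" and ?c = "c(y := c x)"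
    define R where "R = (\<Sum>z\<in>X - {x} - {y}. \<pi> ! c z)"
    have R0: "0 \<le> R" unfolding R_def using c \<pi> by (intro sum_nonneg) (auto intro: prior_nth_nonneg)
    have "\<pi> ! c y + R < ?p"
      using rest[of c] c y X by (simp add: R_def sum.remove[of "X - {x}" y])
    then have R1: "R < ?p" using prior_nth_nonneg[OF \<pi> c(1) y(1)] by simp
    have "(\<Sum>z\<in>X - {x} - {y}. \<pi> ! ?c z) = R"
      unfolding R_def by (intro sum.cong) auto
    \<comment> \<open>As \<open>0 \<le> R < ?p\<close>, the new total lies between
      \<open>2 * ?p\<close> and \<open>3 * ?p\<close>, whence the interval from 1/3 to 1/2.\<close>
    then have "(\<Sum>z\<in>X. \<pi> ! ?c z) = 2 * ?p + R"
      using X y by (simp add: sum.remove[of X x] sum.remove[of "X - {x}" y])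
    then have "freq X \<pi> ?c x = ?p / (2 * ?p + R)" using y by (simp add: freq_def)
    then have "freq X \<pi> ?c x \<in> {1 / 3..1 / 2}"
      using R0 R1 rest(2)[of c] c by (simp add: divide_le_eq le_divide_eq)
    moreover have "?c \<in> ?C" "c y < N"
      using c y X len by (auto simp: assignments_def PiE_iff extensional_def)
    ultimately show "?h u \<in> ?B \<times> {..<N}" by (simp add: uv)
  qed
  ultimately have "card (?A \<times> (X - {x})) \<le> card (?B \<times> {..<N})"
    using X by (intro card_inj_on_le[of ?h]) (auto simp: finite_assignments)
  then have "card ?A * (N - 1) \<le> card ?B * N"
    using X by (simp add: card_cartesian_product)
  also have "\<dots> \<le> card ?B * (2 * (N - 1))"
    using \<open>N \<ge> 2\<close> by (intro mult_left_mono) auto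
  finally have "card ?A * (N - 1) \<le> (2 * card ?B) * (N - 1)" by (simp only: mult_ac)
  then show ?thesis by (rule mult_right_le_imp_le) (use \<open>N \<ge> 2\<close> in simp)
qed

section \<open>Monotonicity of the beta kernel and the splitting bound\<close>

text \<open>The bound \<open>1 + u \<le> exp u\<close> controls both \<open>a / b\<close> and
  \<open>(1 - a) / (1 - b)\<close>; the combined exponent is nonpositive because \<open>b\<close>
  lies at or below the mode \<open>i / (i + j)\<close>.\<close>

lemma beta_kernel_mono:
  fixes a b :: real
  assumes "0 \<le> a" "a \<le> b" "b \<le> 1" "b * (i + j) \<le> i"
  shows "a ^ i * (1 - a) ^ j \<le> b ^ i * (1 - b) ^ j"
\<comment> \<open>The main argument divides by \<open>b\<close> and by \<open>1 - b\<close>. At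
  \<open>b = 1\<close> the last hypothesis forces \<open>j = 0\<close>.\<close>
proof (cases "b = 0 \<or> b = 1")
  case True
  then show ?thesis using assms
    by (auto simp: power_0_left mult_le_one power_le_one)
next
  case False
  then have b: "0 < b" "b < 1" using assms by auto
  have "a = b * (1 - (b - a) / b)" using b by (simp add: field_simps)
  also have "\<dots> \<le> b * exp (- ((b - a) / b))"
    using b exp_ge_add_one_self[of "- ((b - a) / b)"] by (intro mult_left_mono) auto
  finally have 1: "a ^ i \<le> (b * exp (- ((b - a) / b))) ^ i"
    using assms by (intro power_mono)
  have "1 - a = (1 - b) * (1 + (b - a) / (1 - b))" using b by (simp add: field_simps)
  also have "\<dots> \<le> (1 - b) * exp ((b - a) / (1 - b))"
    using b by (intro mult_left_mono exp_ge_add_one_self) auto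
  finally have 2: "(1 - a) ^ j \<le> ((1 - b) * exp ((b - a) / (1 - b))) ^ j"
    using assms by (intro power_mono) auto
  have "a ^ i * (1 - a) ^ j \<le> (b * exp (- ((b - a) / b))) ^ i * ((1 - b) * exp ((b - a) / (1 - b))) ^ j"
    using 1 2 assms b by (intro mult_mono) auto
  also have "\<dots> = b ^ i * (1 - b) ^ j * exp ((b - a) * (j / (1 - b) - i / b))"
  proof -
    have "(b - a) * (j / (1 - b) - i / b) = i * (- ((b - a) / b)) + j * ((b - a) / (1 - b))"
      by (simp add: right_diff_distrib mult.commute)
    then show ?thesis by (simp only: exp_add exp_of_nat_mult power_mult_distrib mult_ac)
  qed
  also have "\<dots> \<le> b ^ i * (1 - b) ^ j * 1"
  proof (intro mult_left_mono)
    have "j / (1 - b) - i / b \<le> 0" using b assms by (simp add: field_simps)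
    then have "(b - a) * (j / (1 - b) - i / b) \<le> 0" using assms by (simp add: mult_nonneg_nonpos)
    then show "exp ((b - a) * (j / (1 - b) - i / b)) \<le> 1" by simp
  qed (use b in auto)
  finally show ?thesis by simp
qed

text \<open>Reflecting \<open>a\<close> to \<open>1 - a\<close> swaps the exponents and reverses the
  order.\<close>

lemma beta_kernel_antimono:
  fixes a b :: real
  assumes "0 \<le> a" "a \<le> b" "b \<le> 1" "i \<le> a * (i + j)"
  shows "b ^ i * (1 - b) ^ j \<le> a ^ i * (1 - a) ^ j"
  using beta_kernel_mono[of "1 - b" "1 - a" j i] assms
  by (simp add: algebra_simps)

text \<open>Here \<open>m\<close> compares the numerator \<open>A\<close> with \<open>W * K\<close>,
  and \<open>\<kappa>\<close> compares \<open>w t / t\<close> with \<open>m\<close>. Cutting the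
  denominator \<open>B\<close> at \<open>t\<close> gives
  \<open>B \<le> \<kappa> * m * K + A / t\<close>; after multiplication by \<open>W\<close> the
  first term is at most \<open>\<kappa> * A\<close>.\<close>

lemma weighted_mean_ge:
  fixes \<alpha> :: "'b \<Rightarrow> real" and n l :: nat
  defines "w \<equiv> \<lambda>a. a ^ l * (1 - a) ^ (n - l)"
  assumes C: "finite C" "\<And>c. c \<in> C \<Longrightarrow> 0 \<le> \<alpha> c \<and> \<alpha> c \<le> 1"
    and l: "2 \<le> l" "l \<le> n"
    and t: "0 < t" "t \<le> (real l - 1) / (real n - 1)"
    and K: "0 < K" "(\<Sum>c\<in>C. \<alpha> c) \<le> K"
    and m: "0 < m" "m * (W * K) \<le> (\<Sum>c\<in>C. \<alpha> c * w (\<alpha> c))" "0 \<le> W"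
    and \<kappa>: "w t \<le> \<kappa> * m * t"
    and s: "0 \<le> s" "s * (W / t + \<kappa>) \<le> 1"
  shows "s * W \<le> (\<Sum>c\<in>C. \<alpha> c ^ (l + 1) * (1 - \<alpha> c) ^ (n - l)) / (\<Sum>c\<in>C. \<alpha> c ^ l * (1 - \<alpha> c) ^ (n - l))"
proof -
  define A B where "A = (\<Sum>c\<in>C. \<alpha> c * w (\<alpha> c))" and "B = (\<Sum>c\<in>C. w (\<alpha> c))"
  have w0: "0 \<le> w (\<alpha> c)" if "c \<in> C" for c using C(2)[OF that] by (simp add: w_def)
  have A0: "0 \<le> A" unfolding A_def using w0 C by (intro sum_nonneg) auto
  have B0: "0 \<le> B" unfolding B_def using w0 by (intro sum_nonneg) auto
  have "(real l - 1) / (real n - 1) \<le> 1" using l by (simp add: divide_le_eq_1)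
  then have t1: "t \<le> 1" using t by linarith
  then have "0 \<le> \<kappa> * m * t" using t by (intro order_trans[OF _ \<kappa>]) (simp add: w_def)
  then have \<kappa>m: "0 \<le> \<kappa> * m" using t by (simp add: zero_le_mult_iff)
  have pointwise: "w (\<alpha> c) \<le> \<kappa> * m * \<alpha> c + \<alpha> c * w (\<alpha> c) / t" if c: "c \<in> C" for c
  proof (cases "\<alpha> c \<le> t")
    case True
    \<comment> \<open>One factor \<open>a\<close> is set aside, to be summed against
      \<open>K\<close>; the rest has its mode at \<open>(l - 1) / (n - 1)\<close>, which is at least
      \<open>t\<close>.\<close>
    have shift: "w a = a * (a ^ (l - 1) * (1 - a) ^ (n - l))" for a
      using l by (cases l) (auto simp: w_def)
    have "\<alpha> c ^ (l - 1) * (1 - \<alpha> c) ^ (n - l) \<le> t ^ (l - 1) * (1 - t) ^ (n - l)"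
      using True C(2)[OF c] t l t1
      by (intro beta_kernel_mono) (auto simp: of_nat_diff field_simps)
    also have "\<dots> \<le> \<kappa> * m" using \<kappa> t by (simp add: shift mult.commute)
    finally have "w (\<alpha> c) \<le> \<alpha> c * (\<kappa> * m)"
      unfolding shift using C(2)[OF c] by (intro mult_left_mono) auto
    then show ?thesis using w0[OF c] C(2)[OF c] t by (simp add: mult.commute add_increasing2)
  next
    case False
    have "w (\<alpha> c) \<le> \<alpha> c * w (\<alpha> c) / t"
      using False w0[OF c] t by (simp add: field_simps mult_right_mono)
    then show ?thesis using C(2)[OF c] \<kappa>m by (simp add: add_increasing)
  qed
  have "B \<le> (\<Sum>c\<in>C. \<kappa> * m * \<alpha> c + \<alpha> c * w (\<alpha> c) / t)"
    unfolding B_def by (intro sum_mono pointwise)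
  also have "\<dots> = \<kappa> * m * (\<Sum>c\<in>C. \<alpha> c) + A / t"
    by (simp add: A_def sum.distrib sum_distrib_left sum_divide_distrib)
  also have "\<dots> \<le> \<kappa> * m * K + A / t"
    using K \<kappa>m by (intro add_mono mult_left_mono) auto
  finally have "W * B \<le> W * (\<kappa> * m * K + A / t)"
    using m by (intro mult_left_mono)
  also have "\<dots> = \<kappa> * (m * (W * K)) + A * (W / t)" by (simp add: algebra_simps)
  also have "\<dots> \<le> \<kappa> * A + A * (W / t)"
    using m \<kappa>m by (intro add_mono mult_left_mono) (use A0 in \<open>auto simp: A_def zero_le_mult_iff\<close>)
  finally have "s * (W * B) \<le> s * (A * (W / t + \<kappa>))"
    using s by (intro mult_left_mono) (auto simp: algebra_simps)
  also have "\<dots> = A * (s * (W / t + \<kappa>))" by simp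
  also have "\<dots> \<le> A * 1" using A0 s by (intro mult_left_mono)
  finally have sWB: "s * W * B \<le> A" by (simp add: mult.assoc)
  have "s * W \<le> A / B"
  \<comment> \<open>For a vanishing denominator the quotient is 0 by convention, so \<open>W\<close>
    has to vanish too.\<close>
  proof (cases "B = 0")
    case True
    then have "A = 0"
      using C w0 by (simp add: A_def B_def sum_nonneg_eq_0_iff)
    then have "m * (W * K) \<le> 0" using m by (simp add: A_def)
    then have "W = 0" using m K by (simp add: mult_le_0_iff)
    then show ?thesis using True by simp
  next
    case False
    then show ?thesis using sWB B0 by (simp add: field_simps)
  qed
  then show ?thesis by (simp add: A_def B_def w_def mult.assoc)
qed


lemma prior_weight_le:
  assumes "finite X" "card X = N" "\<pi> \<noteq> []" "is_prior N \<pi>" "prior_max \<pi> \<le> 1 / 20" "B \<subseteq> {1 / 5..}"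
  shows "prior_weight X \<pi> B \<le> 1 / 32"
proof -
  let ?C = "assignments X \<pi>"
  have "(\<Sum>y\<in>X. freq X \<pi> c y * indicator B (freq X \<pi> c y)) \<le>
      (if (\<Sum>y\<in>X. \<pi> ! c y) \<le> 1 / 4 then 1 else 0)" if c: "c \<in> ?C" for c
  proof (cases "(\<Sum>y\<in>X. \<pi> ! c y) \<le> 1 / 4")
    case True
    have "(\<Sum>y\<in>X. freq X \<pi> c y * indicator B (freq X \<pi> c y)) \<le> (\<Sum>y\<in>X. freq X \<pi> c y)"
      using freq_bounds[OF assms(1,4) c] by (intro sum_mono) (auto simp: indicator_def)
    also have "\<dots> \<le> 1" by (rule sum_freq_le_1)
    finally show ?thesis using True by simp
  next
    case False
    have "freq X \<pi> c y < 1 / 5" if "y \<in> X" for y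
    proof -
      have "c y < length \<pi>" using c that by (auto simp: assignments_def PiE_iff)
      then have "\<pi> ! c y \<le> 1 / 20" using prior_nth_le_max[of "c y" \<pi>] assms by linarith
      then show ?thesis using False by (simp add: freq_def divide_less_eq)
    qed
    then have "freq X \<pi> c y \<notin> B" if "y \<in> X" for y
      using that assms(6) by force
    then show ?thesis using False by simp
  qed
  then have "(\<Sum>c\<in>?C. \<Sum>y\<in>X. freq X \<pi> c y * indicator B (freq X \<pi> c y)) \<le>
      (\<Sum>c\<in>?C. if (\<Sum>y\<in>X. \<pi> ! c y) \<le> 1 / 4 then 1 else 0)"
    by (rule sum_mono)
  also have "\<dots> = card {c \<in> ?C. (\<Sum>y\<in>X. \<pi> ! c y) \<le> 1 / 4}"
    using assms by (simp add: finite_assignments flip: sum.inter_filter)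
  also have "\<dots> \<le> card ?C / 32"
    using assms(1,2,4,5) by (rule card_small_sum_le)
  finally show ?thesis
    using assms(1,3) finite_assignments[of X \<pi>] assignments_nonempty[of \<pi> X]
    unfolding prior_weight_eq[OF assms(1,3)] by (simp add: divide_le_eq card_gt_0_iff)
qed

section \<open>Comparison with the kernel at the cut\<close>

text \<open>The mode of \<open>w\<close> is \<open>\<rho>\<close>. Beyond it \<open>w\<close>
  decreases, but even \<open>4 / 3 * \<rho>\<close> beats \<open>\<rho> / 3\<close>: the first
  factor gains \<open>4 ^ l\<close>, and the second loses no more than that.\<close>

lemma beta_kernel_ge_third:
  fixes n l :: nat and a :: real
  defines "w \<equiv> \<lambda>a :: real. a ^ l * (1 - a) ^ (n - l)"
    and "\<sigma> \<equiv> (real l - 1) / (real n - 1)" and "\<rho> \<equiv> real l / real n"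
  assumes l: "2 \<le> l" "3 * l \<le> n" and a: "\<sigma> / 3 \<le> a" "a \<le> 4 / 3 * \<rho>"
  shows "w (\<sigma> / 3) \<le> w a"
proof -
  have \<rho>: "0 < \<rho>" "3 * \<rho> \<le> 1" "\<rho> * n = l" using l by (auto simp: \<rho>_def field_simps)
  have nl: "real l + real (n - l) = n" using l by simp
  have \<sigma>: "0 \<le> \<sigma>" "\<sigma> \<le> \<rho>"
    using l by (auto simp: \<sigma>_def \<rho>_def field_simps)
  have mono: "w b \<le> w c" if "0 \<le> b" "b \<le> c" "c \<le> \<rho>" for b c
  proof -
    have "c * n \<le> \<rho> * n" using that by (intro mult_right_mono) auto
    then show ?thesis
      unfolding w_def using that \<rho> nl by (intro beta_kernel_mono) auto
  qed
  show ?thesis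
  proof (cases "a \<le> \<rho>")
    case True
    then show ?thesis using a \<sigma> by (intro mono) auto
  next
    case False
    \<comment> \<open>Chosen so that \<open>1 + y\<close> is the ratio of
      \<open>1 - \<rho> / 3\<close> to \<open>1 - 4 / 3 * \<rho>\<close>. The constant 6/5 below is
      the value of \<open>(1 - \<rho>) / (1 - 4 / 3 * \<rho>)\<close> at the extreme
      \<open>\<rho> = 1 / 3\<close>.\<close>
    define y where "y = \<rho> / (1 - 4 / 3 * \<rho>)"
    have pos: "0 < 1 - 4 / 3 * \<rho>" using \<rho> by simp
    have y: "real (n - l) * y \<le> 6 / 5 * l"
    proof -
      have "(n - l) * (\<rho> * n) * 15 \<le> l * 6 * (3 * n - 4 * (\<rho> * n))"
        unfolding \<rho>(3) using l
        by (simp add: of_nat_diff algebra_simps)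
      then have "n * ((n - l) * \<rho> * 15) \<le> n * (l * 6 * (3 - 4 * \<rho>))" by (simp add: algebra_simps)
      then have "(n - l) * \<rho> * 15 \<le> l * 6 * (3 - 4 * \<rho>)" using l by (simp add: mult_le_cancel_left)
      then show ?thesis using pos by (simp add: y_def field_simps)
    qed
    have "(1 - 4 / 3 * \<rho>) * y = \<rho>" using pos by (simp add: y_def)
    then have "(1 - 4 / 3 * \<rho>) * (1 + y) = 1 - \<rho> / 3" by (simp add: distrib_left)
    then have "(1 - \<rho> / 3) ^ (n - l) = ((1 - 4 / 3 * \<rho>) * (1 + y)) ^ (n - l)" by simp
    also have "\<dots> \<le> ((1 - 4 / 3 * \<rho>) * exp y) ^ (n - l)"
      using pos \<rho> by (intro power_mono mult_left_mono exp_ge_add_one_self) (auto simp: y_def)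
    also have "\<dots> = (1 - 4 / 3 * \<rho>) ^ (n - l) * exp (real (n - l) * y)"
      by (simp only: power_mult_distrib exp_of_nat_mult)
    also have "\<dots> \<le> (1 - 4 / 3 * \<rho>) ^ (n - l) * 4 ^ l"
    proof (intro mult_left_mono)
      have "exp (6 / 5) ^ 5 = exp (1 :: real) ^ 6" by (simp flip: exp_of_nat_mult)
      also have "\<dots> \<le> 3 ^ 6" using exp_le by (intro power_mono) auto
      also have "\<dots> \<le> (4 :: real) ^ 5" by simp
      finally have "exp (6 / 5) \<le> (4 :: real)" by (rule power_le_imp_le_base[where n = 4, simplified]) simp
      have "exp (real (n - l) * y) \<le> exp (real l * (6 / 5))" using y by simp
      also have "\<dots> = exp (6 / 5) ^ l" by (rule exp_of_nat_mult)
      also have "\<dots> \<le> 4 ^ l" using \<open>exp (6 / 5) \<le> 4\<close> by (intro power_mono) auto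
      finally show "exp (real (n - l) * y) \<le> 4 ^ l" .
    qed (use pos in auto)
    finally have "w (\<rho> / 3) \<le> (\<rho> / 3) ^ l * ((1 - 4 / 3 * \<rho>) ^ (n - l) * 4 ^ l)"
      unfolding w_def using \<rho> by (intro mult_left_mono) auto
    also have "\<dots> = w (4 / 3 * \<rho>)"
    proof -
      have "(4 / 3 * \<rho>) ^ l = (\<rho> / 3) ^ l * 4 ^ l" by (simp add: mult.commute flip: power_mult_distrib)
      then show ?thesis by (simp only: w_def mult_ac)
    qed
    also have "\<dots> \<le> w a"
    proof -
      have "\<rho> * n \<le> a * n" using False by (intro mult_right_mono) auto
      then show ?thesis
        unfolding w_def using a \<rho> nl False by (intro beta_kernel_antimono) auto
    qed
    finally have "w (\<rho> / 3) \<le> w a" .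
    moreover have "w (\<sigma> / 3) \<le> w (\<rho> / 3)" using \<sigma> \<rho> by (intro mono) auto
    ultimately show ?thesis by simp
  qed
qed

text \<open>Since \<open>n - l \<le> 2 * l\<close>, the ratio of the second factors is at most
  \<open>g ^ (2 * l)\<close>. This reduces the claim to
  \<open>1 / 8 \<le> a * (1 - a)\<^sup>2\<close>, and 81/125 is 8 times 81/1000.\<close>

lemma beta_kernel_tenth_le:
  fixes n l :: nat and a :: real
  assumes "l \<le> n" "n \<le> 3 * l" and a: "1 / 5 \<le> a" "a \<le> 1 / 2"
  shows "(1 / 10) ^ l * (1 - 1 / 10) ^ (n - l) \<le> (81 / 125) ^ l * (a ^ l * (1 - a) ^ (n - l))"
proof -
  have "(a - 1 / 5) * (a - 1 / 2) \<le> 0" using a by (intro mult_nonneg_nonpos) auto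
  then have "a\<^sup>2 - 3 / 2 * a + 1 / 4 \<le> 0" using a by (simp add: algebra_simps power2_eq_square)
  \<comment> \<open>The product equals \<open>a * (1 - a)\<^sup>2 - 1 / 8\<close>.\<close>
  then have "0 \<le> (a - 1 / 2) * (a\<^sup>2 - 3 / 2 * a + 1 / 4)" using a by (intro mult_nonpos_nonpos) auto
  then have cubic: "1 / 8 \<le> a * (1 - a)\<^sup>2" by (simp add: field_simps power2_eq_square)
  define g where "g = (9 / 10) / (1 - a)"
  have "1 - a \<noteq> 0" using a by simp
  then have g: "g * (1 - a) = 9 / 10" using nonzero_eq_divide_eq[of "1 - a" g "9 / 10"] g_def by blast
  have g1: "1 \<le> g" using a by (simp add: g_def)
  have "g\<^sup>2 * (1 / 8) \<le> g\<^sup>2 * (a * (1 - a)\<^sup>2)"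
    using cubic by (intro mult_left_mono) auto
  also have "\<dots> = (g * (1 - a))\<^sup>2 * a" by (simp only: power_mult_distrib mult_ac)
  finally have base: "1 / 10 * g\<^sup>2 \<le> 81 / 125 * a" unfolding g by (simp add: power_divide)
  have "(1 - 1 / 10 :: real) ^ (n - l) = g ^ (n - l) * (1 - a) ^ (n - l)"
    unfolding power_mult_distrib[symmetric] g by simp
  also have "\<dots> \<le> g ^ (2 * l) * (1 - a) ^ (n - l)"
    using g1 a assms by (intro mult_right_mono power_increasing) auto
  finally have "(1 / 10) ^ l * (1 - 1 / 10) ^ (n - l) \<le> (1 / 10) ^ l * (g ^ (2 * l) * (1 - a) ^ (n - l))"
    by (intro mult_left_mono) auto
  also have "\<dots> = (1 / 10 * g\<^sup>2) ^ l * (1 - a) ^ (n - l)"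
    by (simp only: power_mult power_mult_distrib mult.assoc)
  also have "\<dots> \<le> (81 / 125 * a) ^ l * (1 - a) ^ (n - l)"
    using base a by (intro mult_right_mono power_mono) auto
  also have "\<dots> = (81 / 125) ^ l * (a ^ l * (1 - a) ^ (n - l))"
    by (simp only: power_mult_distrib mult.assoc)
  finally show ?thesis .
qed

section \<open>The two regimes of \<open>l\<close> relative to \<open>n / 3\<close>\<close>

text \<open>The case \<open>l = 1\<close> is left out because the cut must satisfy
  \<open>0 < t \<le> (l - 1) / (n - 1)\<close>.\<close>

locale sampled_prior =
  fixes X :: "'a set" and \<pi> :: "real list" and x :: 'a and n l N :: nat
  assumes X: "finite X" "card X = N" "x \<in> X" and \<pi>: "is_prior N \<pi>" and l: "2 \<le> l" "l \<le> n"
begin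

abbreviation "C \<equiv> assignments X \<pi>"
abbreviation "\<alpha> c \<equiv> freq X \<pi> c x"
abbreviation "I \<equiv> {2 / 3 * ((real l - 1) / (real n - 1)) .. 4 / 3 * (real l / real n)}"
abbreviation "W \<equiv> prior_weight X \<pi> I"
abbreviation "K \<equiv> real (card C) / real N"

lemma prior_nonempty: "\<pi> \<noteq> []"
  using \<pi> by (auto simp: is_prior_def)

lemma K_pos: "0 < K"
proof -
  have "card C > 0" "N > 0"
    using X prior_nonempty by (auto simp: card_gt_0_iff finite_assignments assignments_nonempty)
  then show ?thesis by simp
qed

lemma weight_eq: "W * K = (\<Sum>c\<in>C. \<alpha> c * indicator I (\<alpha> c))"
  using prior_weight_mult_card[OF X(1) prior_nonempty X(3), of I] X by simp

lemma weight_bounds: "0 \<le> W" "W \<le> 1"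
proof -
  have "0 \<le> W * K"
    unfolding weight_eq using freq_bounds[OF X(1) \<pi> _ X(3)] by (intro sum_nonneg) auto
  then show "0 \<le> W" using K_pos by (meson mult_neg_pos not_le)
  have "W * K \<le> (\<Sum>c\<in>C. \<alpha> c)"
    unfolding weight_eq using freq_bounds[OF X(1) \<pi> _ X(3)]
    by (intro sum_mono) (auto simp: indicator_def)
  also have "\<dots> \<le> 1 * K" using sum_assignments_freq_le[OF X(1,3), of \<pi>] X by simp
  finally show "W \<le> 1" using K_pos by (rule mult_right_le_imp_le)
qed

lemma tau_ge_of_kernel_bound:
  fixes t m \<kappa> s :: real
  assumes "0 < t" "t \<le> (real l - 1) / (real n - 1)" "0 < m"
    and "m * (W * K) \<le> (\<Sum>c\<in>C. \<alpha> c * (\<alpha> c ^ l * (1 - \<alpha> c) ^ (n - l)))"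
    and "t ^ l * (1 - t) ^ (n - l) \<le> \<kappa> * m * t" "0 \<le> s" "s * (W / t + \<kappa>) \<le> 1"
  shows "s * W \<le> tau X \<pi> x n l"
  unfolding tau_eq[OF X(1) prior_nonempty X(3)]
  using sum_assignments_freq_le[OF X(1,3), of \<pi>] X freq_bounds[OF X(1) \<pi> _ X(3)]
  by (intro weighted_mean_ge[OF _ _ l assms(1,2) K_pos _ assms(3,4) weight_bounds(1) assms(5-7)])
    (auto simp: finite_assignments)

lemma tau_ge_small:
  assumes "3 * l \<le> n"
  shows "0.4 * ((real l * (real l - 1)) / (real n * (real n - 1))) * W \<le> tau X \<pi> x n l"
proof -
  define \<sigma> \<rho> where "\<sigma> = (real l - 1) / (real n - 1)" and "\<rho> = real l / real n"
  define w where "w = (\<lambda>a :: real. a ^ l * (1 - a) ^ (n - l))"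
  have \<sigma>: "0 < \<sigma>" "\<sigma> \<le> 1" and \<rho>: "0 \<le> \<rho>" "3 * \<rho> \<le> 1"
    using l assms by (auto simp: \<sigma>_def \<rho>_def field_simps)
  have wpos: "0 < w (\<sigma> / 3)" using \<sigma> by (simp add: w_def)
  have bound: "w (\<sigma> / 3) * (W * K) \<le> (\<Sum>c\<in>C. \<alpha> c * w (\<alpha> c))"
    unfolding weight_eq sum_distrib_left
  proof (rule sum_mono)
    fix c assume c: "c \<in> C"
    note \<alpha> = freq_bounds[OF X(1) \<pi> c X(3)]
    show "w (\<sigma> / 3) * (\<alpha> c * indicator I (\<alpha> c)) \<le> \<alpha> c * w (\<alpha> c)"
    proof (cases "\<alpha> c \<in> I")
      case True
      then have "2 / 3 * \<sigma> \<le> \<alpha> c" "\<alpha> c \<le> 4 / 3 * \<rho>"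
        unfolding \<sigma>_def \<rho>_def by (simp_all only: atLeastAtMost_iff)
      moreover from this have "\<sigma> / 3 \<le> \<alpha> c" using \<sigma> by linarith
      ultimately have "w (\<sigma> / 3) \<le> w (\<alpha> c)"
        unfolding w_def \<sigma>_def \<rho>_def by (intro beta_kernel_ge_third[OF l(1) assms])
      then show ?thesis using True \<alpha> by (simp add: mult.commute mult_left_mono)
    next
      case False
      then show ?thesis using \<alpha> by (simp add: w_def)
    qed
  qed
  have s: "0.4 * ((real l * (real l - 1)) / (real n * (real n - 1))) = 0.4 * \<rho> * \<sigma>"
    by (simp add: \<sigma>_def \<rho>_def)
  \<comment> \<open>With \<open>t = \<sigma> / 3\<close> and \<open>m = w t\<close>, the choice
    \<open>\<kappa> = 1 / t\<close> makes the condition on \<open>\<kappa>\<close> an equality; the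
    bound obtained is 0.8.\<close>
  have "0.4 * \<rho> * \<sigma> * (W / (\<sigma> / 3) + 3 / \<sigma>) = 0.4 * (3 * \<rho>) * (W + 1)"
    using \<sigma> by (simp add: field_simps)
  also have "\<dots> \<le> 0.4 * 1 * (1 + 1)"
    using \<rho> weight_bounds by (intro mult_mono add_mono) auto
  finally have le1: "0.4 * \<rho> * \<sigma> * (W / (\<sigma> / 3) + 3 / \<sigma>) \<le> 1" by simp
  show ?thesis
    unfolding s
    by (rule tau_ge_of_kernel_bound[where t = "\<sigma> / 3" and m = "w (\<sigma> / 3)" and \<kappa> = "3 / \<sigma>"])
      (use \<sigma> \<rho> wpos bound le1 in \<open>auto simp: \<sigma>_def[symmetric] w_def\<close>)
qed

text \<open>All weight is charged to \<open>M\<close>: at most \<open>2 * card M\<close> assignments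
  have \<open>\<alpha> c > 1 / 2\<close>, and on \<open>M\<close> the kernel is at least
  \<open>w (1 / 10) / r ^ l\<close>.\<close>

lemma tau_ge_large:
  assumes "n \<le> 3 * l" "60 \<le> n" "2 \<le> N" and max: "prior_max \<pi> \<le> 1 / 20"
  shows "0.4 * ((real l * (real l - 1)) / (real n * (real n - 1))) * W \<le> tau X \<pi> x n l"
proof -
  define \<sigma> \<rho> where "\<sigma> = (real l - 1) / (real n - 1)" and "\<rho> = real l / real n"
  define w where "w = (\<lambda>a :: real. a ^ l * (1 - a) ^ (n - l))"
  define r :: real where "r = 81 / 125"
  define M where "M = {c \<in> C. \<alpha> c \<in> {1 / 5..1 / 2}}"
  have "real n \<le> 3 * real l" "60 \<le> real n" using assms by linarith+
  \<comment> \<open>With \<open>0.3 \<le> \<sigma>\<close> the interval starts at 1/5 or above, and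
    the cut 1/10 lies below \<open>\<sigma>\<close>.\<close>
  then have "0.3 * (real n - 1) \<le> real l - 1" by simp
  then have \<sigma>: "0.3 \<le> \<sigma>" "\<sigma> \<le> 1" and \<rho>: "0 \<le> \<rho>" "\<rho> \<le> 1"
    using l by (auto simp: \<sigma>_def \<rho>_def le_divide_eq divide_le_eq)
  have I: "I \<subseteq> {1 / 5..}"
  proof
    fix a assume "a \<in> I"
    then have "2 / 3 * \<sigma> \<le> a" unfolding \<sigma>_def by (simp only: atLeastAtMost_iff)
    then show "a \<in> {1 / 5..}" using \<sigma> by simp
  qed
  then have W32: "W \<le> 1 / 32"
    using X(1,2) prior_nonempty \<pi> max by (intro prior_weight_le)
  have r: "0 < r" "r ^ l \<le> 1 / 150"
  proof -
    show "0 < r" by (simp add: r_def)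
    \<comment> \<open>From \<open>60 \<le> n \<le> 3 * l\<close> one gets
      \<open>20 \<le> l\<close>.\<close>
    have "r ^ l \<le> r ^ 20" using assms by (intro power_decreasing) (auto simp: r_def)
    also have "\<dots> \<le> 1 / 150" by (simp add: r_def power_divide)
    finally show "r ^ l \<le> 1 / 150" .
  qed
  have finC: "finite C" using X by (simp add: finite_assignments)
  have wpos: "0 < w (1 / 10)" by (simp add: w_def)
  have nonneg: "0 \<le> \<alpha> c * w (\<alpha> c)" if "c \<in> C" for c
    using freq_bounds[OF X(1) \<pi> that X(3)] by (simp add: w_def)
  have "W * K \<le> (\<Sum>c\<in>C. indicator {c. 1 / 5 \<le> \<alpha> c} c)"
    unfolding weight_eq
  proof (rule sum_mono)
    fix c assume c: "c \<in> C"
    show "\<alpha> c * indicator I (\<alpha> c) \<le> indicator {c. 1 / 5 \<le> \<alpha> c} c"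
    proof (cases "\<alpha> c \<in> I")
      case True
      then have "1 / 5 \<le> \<alpha> c" using I by (meson atLeast_iff subsetD)
      then show ?thesis using freq_bounds[OF X(1) \<pi> c X(3)] by (simp add: indicator_def)
    qed simp
  qed
  also have "\<dots> = card {c \<in> C. 1 / 5 \<le> \<alpha> c}"
    using finC by (simp add: indicator_def of_bool_def flip: sum.inter_filter)
  also have "{c \<in> C. 1 / 5 \<le> \<alpha> c} \<subseteq> M \<union> {c \<in> C. \<alpha> c > 1 / 2}" by (auto simp: M_def)
  then have "card {c \<in> C. 1 / 5 \<le> \<alpha> c} \<le> card (M \<union> {c \<in> C. \<alpha> c > 1 / 2})"
    using finC by (intro card_mono) (auto simp: M_def)
  also have "\<dots> \<le> card M + card {c \<in> C. \<alpha> c > 1 / 2}" by (rule card_Un_le)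
  also have "card {c \<in> C. \<alpha> c > 1 / 2} \<le> 2 * card {c \<in> C. \<alpha> c \<in> {1 / 3..1 / 2}}"
    using X \<pi> assms(3) by (rule card_large_freq_le)
  also have "card {c \<in> C. \<alpha> c \<in> {1 / 3..1 / 2}} \<le> card M"
    using finC by (intro card_mono) (auto simp: M_def)
  finally have WK: "W * K \<le> 3 * real (card M)" by simp
  \<comment> \<open>The 15 is 3 from \<open>WK\<close> times 5 from
    \<open>1 / 5 \<le> \<alpha> c\<close>.\<close>
  have "w (1 / 10) / (15 * r ^ l) * (W * K) \<le> w (1 / 10) / (15 * r ^ l) * (3 * real (card M))"
    using WK wpos r by (intro mult_left_mono) auto
  also have "\<dots> = (\<Sum>c\<in>M. 1 / 5 * (w (1 / 10) / r ^ l))" by simp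
  also have "\<dots> \<le> (\<Sum>c\<in>M. \<alpha> c * w (\<alpha> c))"
  proof (rule sum_mono)
    fix c assume "c \<in> M"
    then have \<alpha>: "1 / 5 \<le> \<alpha> c" "\<alpha> c \<le> 1 / 2" by (auto simp: M_def)
    have "w (1 / 10) / r ^ l \<le> w (\<alpha> c)"
      using beta_kernel_tenth_le[OF l(2) assms(1) \<alpha>] r(1)
      by (simp add: w_def r_def divide_le_eq mult.commute)
    then show "1 / 5 * (w (1 / 10) / r ^ l) \<le> \<alpha> c * w (\<alpha> c)"
      using \<alpha> wpos r by (intro mult_mono) auto
  qed
  also have "\<dots> \<le> (\<Sum>c\<in>C. \<alpha> c * w (\<alpha> c))"
    using nonneg finC by (intro sum_mono2) (auto simp: M_def)
  finally have bound: "w (1 / 10) / (15 * r ^ l) * (W * K) \<le> (\<Sum>c\<in>C. \<alpha> c * w (\<alpha> c))" .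
  have s: "0.4 * ((real l * (real l - 1)) / (real n * (real n - 1))) = 0.4 * (\<rho> * \<sigma>)"
    by (simp add: \<sigma>_def \<rho>_def)
  \<comment> \<open>The choice \<open>\<kappa> = 150 * r ^ l\<close> gives
    \<open>\<kappa> * m * t = w t\<close>; the right-hand side is 0.525.\<close>
  have "0.4 * (\<rho> * \<sigma>) * (W / (1 / 10) + 150 * r ^ l) \<le> 0.4 * (1 * 1) * (1 / 32 / (1 / 10) + 150 * (1 / 150))"
    using \<rho> \<sigma> r W32 weight_bounds by (intro mult_mono add_mono divide_right_mono) auto
  then have le1: "0.4 * (\<rho> * \<sigma>) * (W / (1 / 10) + 150 * r ^ l) \<le> 1" by simp
  show ?thesis
    unfolding s
    by (rule tau_ge_of_kernel_bound[where t = "1 / 10" and m = "w (1 / 10) / (15 * r ^ l)" and \<kappa> = "150 * r ^ l"])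
      (use \<sigma> \<rho> wpos r bound le1 in \<open>auto simp: \<sigma>_def[symmetric] w_def\<close>)
qed

end

theorem theorem4:
  "\<exists>n0 N0 :: nat. \<forall>n \<ge> n0. \<forall>N \<ge> N0. \<forall>(X :: 'a set) (\<pi> :: real list). \<forall>x\<in>X. \<forall>l\<in>{1..n}.
     finite X \<longrightarrow> card X = N \<longrightarrow> is_prior N \<pi> \<longrightarrow> prior_max \<pi> \<le> 1 / 20 \<longrightarrow>
     tau X \<pi> x n l \<ge>
       0.4 * ((real l * (real l - 1)) / (real n * (real n - 1))) *
       prior_weight X \<pi> {2 / 3 * ((real l - 1) / (real n - 1)) .. 4 / 3 * (real l / real n)}"
proof (rule exI[of _ 60], rule exI[of _ 2], intro allI impI ballI)
  \<comment> \<open>The threshold 60 makes \<open>r ^ l\<close> small in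
    \<open>tau_ge_large\<close>; the threshold 2 provides a second point to overwrite in
    \<open>card_large_freq_le\<close>.\<close>
  fix n N l :: nat and X :: "'a set" and \<pi> :: "real list" and x
  assume n: "60 \<le> n" and N: "2 \<le> N" and x: "x \<in> X" and l: "l \<in> {1..n}"
    and X: "finite X" "card X = N" and \<pi>: "is_prior N \<pi>" and max: "prior_max \<pi> \<le> 1 / 20"
  show "tau X \<pi> x n l \<ge>
       0.4 * ((real l * (real l - 1)) / (real n * (real n - 1))) *
       prior_weight X \<pi> {2 / 3 * ((real l - 1) / (real n - 1)) .. 4 / 3 * (real l / real n)}"
  proof (cases "l = 1")
    case True
    \<comment> \<open>The factor \<open>l - 1\<close> makes the right-hand side 0, so only the sign
      of \<open>tau\<close> matters.\<close>
    have "\<pi> \<noteq> []" using \<pi> by (auto simp: is_prior_def)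
    then have "0 \<le> tau X \<pi> x n l"
      using X x freq_bounds[OF X(1) \<pi> _ x]
      by (subst tau_eq) (auto intro!: divide_nonneg_nonneg sum_nonneg)
    then show ?thesis using True by simp
  next
    case False
    then interpret sampled_prior X \<pi> x n l N
      using l X x \<pi> by unfold_locales auto
    show ?thesis
    proof (cases "3 * l \<le> n")
      case True
      then show ?thesis by (rule tau_ge_small)
    next
      case False
      then show ?thesis using n N max by (intro tau_ge_large) auto
    qed
  qed
qed

end
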